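(* Let $C$ be drawn uniformly from $\mathcal{E}_n$. Then $$ \mathbb{E}\|C - I_n\|_F^2 = \frac{n(n-1)}{n+1}=n(1+o(1)), $$ and $\|C-I_n\|_F^2/\mathbb{E}\|C-I_n\|_F^2\rightarrow1$ in probability as $n\rightarrow\infty$.
   Context: $\mathcal{E}_n=\{C\in\mathbb{R}^{n\times n}: C=C',\ C\succeq 0,\ C_{ii}=1 \text{ for all } i\}$ is the set of $n\times n$ correlation matrices; the uniform distribution on it is normalized $d$-dimensional Lebesgue measure, $d=n(n-1)/2$, in the off-diagonal coordinates $(C_{ij})_{i<j}$. $\|\cdot\|_F$ is the Frobenius norm. *)

theory Defs
  imports
    "HOL-Probability.Probability"
    "HOL-Library.Landau_Symbols"
    "Jordan_Normal_Form.Matrix"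
begin

(* From here on the bullet is the scalar product of Jordan_Normal_Form vectors. *)
unbundle no inner_syntax

definition pos_semidef :: "real mat \<Rightarrow> bool" where
  "pos_semidef A \<longleftrightarrow> square_mat A \<and> (\<forall>v \<in> carrier_vec (dim_row A). v \<bullet> (A *\<^sub>v v) \<ge> 0)"

definition frobenius_norm :: "real mat \<Rightarrow> real" where
  "frobenius_norm A = sqrt (\<Sum>i<dim_row A. \<Sum>j<dim_col A. (A $$ (i, j))\<^sup>2)"

definition correlation_matrices :: "nat \<Rightarrow> real mat set" where
  "correlation_matrices n =
     {C \<in> carrier_mat n n. C = transpose_mat C \<and> pos_semidef C \<and> (\<forall>i<n. C $$ (i, i) = 1)}"

definition upper_indices :: "nat \<Rightarrow> (nat \<times> nat) set" where
  "upper_indices n = {(i, j). i < j \<and> j < n}"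

definition unit_diag_mat :: "nat \<Rightarrow> (nat \<times> nat \<Rightarrow> real) \<Rightarrow> real mat" where
  "unit_diag_mat n x =
     mat n n (\<lambda>(i, j). if i = j then 1 else if i < j then x (i, j) else x (j, i))"

(* Lebesgue measure in the coordinates above the diagonal, carried over to the space of all
   symmetric n x n matrices with unit diagonal; the product measure lives on extensional
   functions, on which unit_diag_mat n is injective (lemma below). *)
definition unit_diag_lebesgue :: "nat \<Rightarrow> real mat measure" where
  "unit_diag_lebesgue n =
     embed_measure (\<Pi>\<^sub>M ij\<in>upper_indices n. lborel) (unit_diag_mat n)"

definition uniform_correlation :: "nat \<Rightarrow> real mat measure" where
  "uniform_correlation n = uniform_measure (unit_diag_lebesgue n) (correlation_matrices n)"

lemma inj_on_unit_diag_mat: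
  "inj_on (unit_diag_mat n) (space (\<Pi>\<^sub>M ij\<in>upper_indices n. lborel))"
proof (rule inj_onI)
  fix x y :: "nat \<times> nat \<Rightarrow> real"
  assume x: "x \<in> space (\<Pi>\<^sub>M ij\<in>upper_indices n. lborel)"
    and y: "y \<in> space (\<Pi>\<^sub>M ij\<in>upper_indices n. lborel)"
    and eq: "unit_diag_mat n x = unit_diag_mat n y"
  have "x ij = y ij" if ij: "ij \<in> upper_indices n" for ij
  proof -
    obtain i j where "ij = (i, j)" "i < j" "j < n"
      using ij by (auto simp: upper_indices_def)
    moreover from this have "unit_diag_mat n z $$ (i, j) = z (i, j)" for z
      by (simp add: unit_diag_mat_def)
    ultimately show ?thesis
      using eq by metis
  qed
  then show "x = y"
    using x y by (auto simp: space_PiM intro: PiE_ext)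
qed

lemma space_unit_diag_lebesgue:
  "space (unit_diag_lebesgue n) =
     {C \<in> carrier_mat n n. C = transpose_mat C \<and> (\<forall>i<n. C $$ (i, i) = 1)}"
proof (intro equalityI subsetI)
  fix C assume "C \<in> space (unit_diag_lebesgue n)"
  then show "C \<in> {C \<in> carrier_mat n n. C = transpose_mat C \<and> (\<forall>i<n. C $$ (i, i) = 1)}"
    by (auto simp: unit_diag_lebesgue_def space_embed_measure unit_diag_mat_def)
next
  fix C :: "real mat"
  assume C: "C \<in> {C \<in> carrier_mat n n. C = transpose_mat C \<and> (\<forall>i<n. C $$ (i, i) = 1)}"
  define x where "x = restrict (\<lambda>ij. C $$ ij) (upper_indices n)"
  have sym: "C $$ (i, j) = C $$ (j, i)" if "i < n" "j < n" for i j
    using C that by (metis (mono_tags, lifting) carrier_matD index_transpose_mat(1) mem_Collect_eq)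
  have "C = unit_diag_mat n x"
    using C sym by (intro eq_matI) (auto simp: unit_diag_mat_def x_def upper_indices_def)
  moreover have "x \<in> space (\<Pi>\<^sub>M ij\<in>upper_indices n. lborel)"
    by (auto simp: x_def space_PiM)
  ultimately show "C \<in> space (unit_diag_lebesgue n)"
    by (auto simp: unit_diag_lebesgue_def space_embed_measure)
qed

end

theory Submission
  imports Defs "HOL-Real_Asymp.Real_Asymp"
begin

text \<open>
  Fix \<open>p \<noteq> q\<close>, let \<open>c = C p q\<close> and \<open>s = sqrt (1 - c\<^sup>2)\<close>, and substitute
  \<open>C q k = c * C p k + s * y k\<close> for \<open>k \<notin> {p, q}\<close>. This writes \<open>C = T C\<^sub>0 T'\<close> where \<open>C\<^sub>0\<close> has
  \<open>p, q\<close> entry \<open>0\<close>, and \<open>T\<close> is invertible when \<open>\<bar>c\<bar> < 1\<close>, so \<open>C\<close> is positive semidefinite iff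
  \<open>C\<^sub>0\<close> is. The Jacobian is \<open>s ^ (n - 2)\<close>, and entries outside row and column \<open>q\<close> do not change.
  Hence under the uniform distribution \<open>C p q\<close> has density proportional to
  \<open>(1 - c\<^sup>2) powr ((n - 2) / 2)\<close>, with second moment \<open>1 / (n + 1)\<close>, and is independent of all
  entries outside row and column \<open>q\<close>. Of two distinct index pairs, one always has an endpoint that
  the other avoids, so distinct squared entries are uncorrelated. Therefore the variance of their
  sum is at most its mean, and Chebyshev's inequality gives the concentration.
\<close>

section \<open>Correlation matrices in upper triangular coordinates\<close>

text \<open>The increasing representative of the unordered pair \<open>{i, j}\<close>. It lets the
  row of an arbitrary index \<open>q\<close> be addressed without splitting on the order of the
  indices.\<close>

definition upair :: "nat \<Rightarrow> nat \<Rightarrow> nat \<times> nat" where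
  "upair i j = (min i j, max i j)"

definition entry :: "(nat \<times> nat \<Rightarrow> real) \<Rightarrow> nat \<Rightarrow> nat \<Rightarrow> real" where
  "entry x i j = (if i = j then 1 else x (upair i j))"

definition qform :: "nat \<Rightarrow> (nat \<times> nat \<Rightarrow> real) \<Rightarrow> (nat \<Rightarrow> real) \<Rightarrow> real" where
  "qform n x v = (\<Sum>i<n. \<Sum>j<n. entry x i j * v i * v j)"

text \<open>Correlation matrices in coordinates, as
  \<open>unit_diag_mat_in_correlation_matrices\<close> confirms. Test vectors are total functions,
  of which only the values below \<open>n\<close> matter, so they can be updated without carrier
  conditions.\<close>

definition elliptope :: "nat \<Rightarrow> (nat \<times> nat \<Rightarrow> real) set" where
  "elliptope n = {x \<in> space (\<Pi>\<^sub>M ij\<in>upper_indices n. lborel). \<forall>v. 0 \<le> qform n x v}"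

section \<open>Unordered index pairs and symmetric double sums\<close>

lemma upair_commute: "upair i j = upair j i"
  by (simp add: upair_def min.commute max.commute)

lemma entry_commute: "entry x i j = entry x j i"
  by (simp add: entry_def upair_commute)

lemma upair_eq_iff: "upair i j = upair k l \<longleftrightarrow> (i = k \<and> j = l) \<or> (i = l \<and> j = k)"
  by (auto simp: upair_def min_def max_def split: if_splits)

lemma upair_in_upper_indices: "upair i j \<in> upper_indices n \<longleftrightarrow> i < n \<and> j < n \<and> i \<noteq> j"
  by (auto simp: upair_def upper_indices_def min_def max_def)

lemma upper_indicesE:
  assumes "e \<in> upper_indices n"
  obtains i j where "e = upair i j" "i < n" "j < n" "i \<noteq> j"
  using assms by (auto simp: upper_indices_def upair_def intro!: that[of "fst e" "snd e"])

lemma finite_upper_indices: "finite (upper_indices n)"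
proof (rule finite_subset)
  show "upper_indices n \<subseteq> {..<n} \<times> {..<n}"
    by (auto simp: upper_indices_def)
qed simp

text \<open>Enlarging the square by one adds a diagonal term together with a new row and a new
  column, and these two have equal sums by symmetry. Used for counting pairs and for the Frobenius
  norm.\<close>

lemma sum_square_symmetric:
  fixes a :: "nat \<Rightarrow> nat \<Rightarrow> real"
  assumes "\<And>i j. a i j = a j i"
  shows "(\<Sum>i<n. \<Sum>j<n. a i j) = (\<Sum>i<n. a i i) + 2 * (\<Sum>(i, j)\<in>upper_indices n. a i j)"
proof (induction n)
  case 0
  then show ?case by (simp add: upper_indices_def)
next
  case (Suc n)
  have eq: "upper_indices (Suc n) = upper_indices n \<union> (\<lambda>i. (i, n)) ` {..<n}"
    by (auto simp: upper_indices_def less_Suc_eq)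
  have "(\<Sum>(i, j)\<in>upper_indices (Suc n). a i j)
      = (\<Sum>(i, j)\<in>upper_indices n. a i j) + (\<Sum>(i, j)\<in>(\<lambda>i. (i, n)) ` {..<n}. a i j)"
    unfolding eq by (rule sum.union_disjoint) (use finite_upper_indices[of n] in \<open>auto simp: upper_indices_def\<close>)
  also have "(\<Sum>(i, j)\<in>(\<lambda>i. (i, n)) ` {..<n}. a i j) = (\<Sum>i<n. a i n)"
    by (subst sum.reindex) (auto simp: inj_on_def)
  finally have upper: "(\<Sum>(i, j)\<in>upper_indices (Suc n). a i j)
      = (\<Sum>(i, j)\<in>upper_indices n. a i j) + (\<Sum>i<n. a i n)" .
  have "(\<Sum>j<n. a n j) = (\<Sum>i<n. a i n)"
    by (intro sum.cong refl assms)
  then show ?case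
    by (simp add: Suc.IH upper sum.distrib)
qed

lemma card_upper_indices: "real (card (upper_indices n)) = real n * (real n - 1) / 2"
  using sum_square_symmetric[of "\<lambda>_ _. 1" n] by (simp add: algebra_simps split_def)

text \<open>Isolates the rows and columns \<open>p\<close> and \<open>q\<close>, the only places
  where the shear changes the test vector.\<close>

lemma sum_square_split_two:
  fixes a :: "nat \<Rightarrow> nat \<Rightarrow> real"
  assumes "p < n" "q < n" "p \<noteq> q" and sym: "\<And>i j. a i j = a j i"
  defines "R \<equiv> {..<n} - {p, q}"
  shows "(\<Sum>i<n. \<Sum>j<n. a i j) = a p p + a q q + 2 * a p q
    + 2 * (\<Sum>k\<in>R. a p k) + 2 * (\<Sum>k\<in>R. a q k) + (\<Sum>i\<in>R. \<Sum>j\<in>R. a i j)"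
proof -
  have ins: "{..<n} = insert p (insert q R)" and R: "finite R" "p \<notin> R" "q \<notin> R"
    using assms by auto
  have split: "(\<Sum>j<n. f j) = f p + f q + (\<Sum>j\<in>R. f j)" for f :: "nat \<Rightarrow> real"
    using R assms(3) by (subst ins) simp
  have col: "(\<Sum>i\<in>R. a i k) = (\<Sum>i\<in>R. a k i)" for k
    by (intro sum.cong refl sym)
  show ?thesis
    by (simp add: split sum.distrib col sym[of q p])
qed

text \<open>In matrix terms \<open>x = T y T'\<close>, where \<open>T\<close> is the identity except
  that its row \<open>q\<close> has \<open>c\<close> in column \<open>p\<close> and \<open>s\<close>
  in column \<open>q\<close>. Hence the form of \<open>x\<close> at \<open>v\<close> is the form of
  \<open>y\<close> at \<open>T' v\<close>, which is the updated vector.\<close>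

lemma qform_shear:
  assumes pq: "p < n" "q < n" "p \<noteq> q" and s: "s\<^sup>2 = 1 - c\<^sup>2"
    and x_pq: "x (upair p q) = c" and y_pq: "y (upair p q) = 0"
    and x_p: "\<And>k. k < n \<Longrightarrow> k \<noteq> p \<Longrightarrow> k \<noteq> q \<Longrightarrow> x (upair p k) = y (upair p k)"
    and x_q: "\<And>k. k < n \<Longrightarrow> k \<noteq> p \<Longrightarrow> k \<noteq> q \<Longrightarrow>
                 x (upair q k) = c * y (upair p k) + s * y (upair q k)"
    and x_rest: "\<And>i j. i < n \<Longrightarrow> j < n \<Longrightarrow> {i, j} \<inter> {p, q} = {} \<Longrightarrow> i \<noteq> j \<Longrightarrow>
                   x (upair i j) = y (upair i j)"
  shows "qform n x v = qform n y (v(p := v p + c * v q, q := s * v q))"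
proof -
  define R where "R = {..<n} - {p, q}"
  define w where "w = v(p := v p + c * v q, q := s * v q)"
  have w: "w p = v p + c * v q" "w q = s * v q" "\<And>k. k \<in> R \<Longrightarrow> w k = v k"
    using pq by (auto simp: w_def R_def)
  have split: "qform n z u = u p * u p + u q * u q + 2 * (z (upair p q) * u p * u q)
      + 2 * u p * (\<Sum>k\<in>R. z (upair p k) * u k) + 2 * u q * (\<Sum>k\<in>R. z (upair q k) * u k)
      + (\<Sum>i\<in>R. \<Sum>j\<in>R. entry z i j * u i * u j)" for z u
  proof -
    have "(\<Sum>k\<in>R. entry z i k * u i * u k) = u i * (\<Sum>k\<in>R. z (upair i k) * u k)"
      if "i \<notin> R" for i
      unfolding sum_distrib_left
      by (intro sum.cong refl) (use that in \<open>auto simp: entry_def\<close>)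
    then have "(\<Sum>k\<in>R. entry z p k * u p * u k) = u p * (\<Sum>k\<in>R. z (upair p k) * u k)"
      "(\<Sum>k\<in>R. entry z q k * u q * u k) = u q * (\<Sum>k\<in>R. z (upair q k) * u k)"
      by (simp_all add: R_def)
    then show ?thesis
      unfolding qform_def R_def
      by (subst sum_square_split_two[OF pq])
         (use pq in \<open>auto simp: entry_def upair_commute algebra_simps\<close>)
  qed
  have "(\<Sum>k\<in>R. x (upair p k) * v k) = (\<Sum>k\<in>R. y (upair p k) * w k)"
    by (intro sum.cong refl) (auto simp: w x_p R_def w_def)
  moreover have "(\<Sum>k\<in>R. x (upair q k) * v k)
      = c * (\<Sum>k\<in>R. y (upair p k) * w k) + s * (\<Sum>k\<in>R. y (upair q k) * w k)"
    unfolding sum_distrib_left sum.distrib[symmetric]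
    by (intro sum.cong refl) (auto simp: x_q R_def w_def algebra_simps)
  moreover have "(\<Sum>i\<in>R. \<Sum>j\<in>R. entry x i j * v i * v j) = (\<Sum>i\<in>R. \<Sum>j\<in>R. entry y i j * w i * w j)"
    by (intro sum.cong refl) (auto simp: w x_rest entry_def R_def w_def)
  \<comment> \<open>This is the preserved unit diagonal entry at \<open>q\<close>: the cross term of
    the new entry vanishes because \<open>y (upair p q) = 0\<close>.\<close>
  moreover have "v q * v q = (c * c + s * s) * (v q * v q)"
    using s by (simp add: power2_eq_square)
  ultimately show ?thesis
    unfolding w_def[symmetric] split w(1,2) x_pq y_pq by (simp add: algebra_simps)
qed

section \<open>Measurability of the elliptope\<close>

lemma floor_mult_over_tendsto: "(\<lambda>m. of_int \<lfloor>real m * a\<rfloor> / real m) \<longlonglongrightarrow> a"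
proof (rule LIM_zero_cancel, rule Lim_null_comparison)
  have "\<bar>of_int \<lfloor>real m * a\<rfloor> / real m - a\<bar> \<le> 1 / real m" if "m > 0" for m
  proof -
    have "of_int \<lfloor>real m * a\<rfloor> / real m - a = (of_int \<lfloor>real m * a\<rfloor> - real m * a) / real m"
      using that by (simp add: field_simps)
    then have "\<bar>of_int \<lfloor>real m * a\<rfloor> / real m - a\<bar> = \<bar>of_int \<lfloor>real m * a\<rfloor> - real m * a\<bar> / real m"
      by simp
    also have "\<dots> \<le> 1 / real m"
      by (intro divide_right_mono) linarith+
    finally show ?thesis .
  qed
  then show "\<forall>\<^sub>F m in sequentially. norm (of_int \<lfloor>real m * a\<rfloor> / real m - a) \<le> 1 / real m"
    by (intro eventually_sequentiallyI[of 1]) simp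
qed (rule lim_1_over_n)

lemma qform_scale: "qform n x (\<lambda>i. a * v i) = a\<^sup>2 * qform n x v"
  by (simp add: qform_def sum_distrib_left power2_eq_square mult_ac)

text \<open>Replaces an uncountable family of inequalities by a countable one, as measurability
  requires. The form is homogeneous, so integer vectors cover the rational approximations with
  denominator \<open>m\<close>, and continuity does the rest. Extensionality on
  \<open>{..<n}\<close> keeps the index set countable.\<close>

lemma qform_nonneg_iff_int:
  "(\<forall>v. 0 \<le> qform n x v) \<longleftrightarrow>
   (\<forall>w \<in> {..<n} \<rightarrow>\<^sub>E (UNIV :: int set). 0 \<le> qform n x (\<lambda>i. of_int (w i)))"
proof (intro iffI allI)
  fix v
  assume *: "\<forall>w \<in> {..<n} \<rightarrow>\<^sub>E (UNIV :: int set). 0 \<le> qform n x (\<lambda>i. of_int (w i))"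
  have "(\<lambda>m. qform n x (\<lambda>i. of_int \<lfloor>real m * v i\<rfloor> / real m)) \<longlonglongrightarrow> qform n x v"
    unfolding qform_def by (intro tendsto_intros floor_mult_over_tendsto)
  moreover have "0 \<le> qform n x (\<lambda>i. of_int \<lfloor>real m * v i\<rfloor> / real m)" for m
  proof -
    have "0 \<le> qform n x (\<lambda>i. of_int (restrict (\<lambda>i. \<lfloor>real m * v i\<rfloor>) {..<n} i))"
      by (rule *[rule_format], rule restrict_PiE_iff[THEN iffD2]) simp
    also have "\<dots> = qform n x (\<lambda>i. of_int \<lfloor>real m * v i\<rfloor>)"
      by (simp add: qform_def)
    finally show ?thesis
      using qform_scale[of n x "1 / real m" "\<lambda>i. of_int \<lfloor>real m * v i\<rfloor>"] by simp
  qed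
  ultimately show "0 \<le> qform n x v"
    by (intro LIMSEQ_le_const) auto
qed auto

lemma sets_elliptope [measurable]: "elliptope n \<in> sets (\<Pi>\<^sub>M ij\<in>upper_indices n. lborel)"
proof -
  have "(\<lambda>x. entry x i j) \<in> borel_measurable (\<Pi>\<^sub>M ij\<in>upper_indices n. lborel)"
    if "i < n" "j < n" for i j
  proof (cases "i = j")
    case False
    then have "(\<lambda>x. x (upair i j)) \<in> (\<Pi>\<^sub>M ij\<in>upper_indices n. lborel) \<rightarrow>\<^sub>M (lborel :: real measure)"
      using that by (intro measurable_component_singleton) (simp add: upair_in_upper_indices)
    then show ?thesis
      using False by (simp add: entry_def)
  qed (simp add: entry_def)
  then have [measurable]: "(\<lambda>x. qform n x v) \<in> borel_measurable (\<Pi>\<^sub>M ij\<in>upper_indices n. lborel)" for v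
    unfolding qform_def by (intro borel_measurable_sum borel_measurable_times) auto
  have "countable ({..<n} \<rightarrow>\<^sub>E (UNIV :: int set))"
    by (intro countable_PiE) auto
  then show ?thesis
    unfolding elliptope_def qform_nonneg_iff_int
    by (intro sets.sets_Collect_countable_All') measurable
qed

section \<open>Bounds on the entries and on the volume of the elliptope\<close>

lemma abs_le_1_if_elliptope:
  assumes "x \<in> elliptope n" "i < n" "j < n" "i \<noteq> j"
  shows "\<bar>x (upair i j)\<bar> \<le> 1"
proof -
  have "0 \<le> 2 + 2 * a * x (upair i j)" if "a = 1 \<or> a = -1" for a
  proof -
    \<comment> \<open>The two signs of \<open>a\<close> give the upper and the lower bound on the
      entry.\<close>
    let ?v = "\<lambda>k. if k = i then 1 else if k = j then a else 0 :: real"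
    have "0 \<le> qform n x ?v"
      using assms by (simp add: elliptope_def)
    also have "qform n x ?v = 2 + 2 * a * x (upair i j)"
      unfolding qform_def
      by (subst sum_square_split_two[OF assms(2-4)])
         (use assms that in \<open>auto simp: entry_commute entry_def upair_commute\<close>)
    finally show ?thesis .
  qed
  from this[of 1] this[of "-1"] show ?thesis by auto
qed

text \<open>Small off-diagonal entries cannot outweigh the unit diagonal: their contribution is at
  most \<open>(\<Sum>i<n. \<bar>v i\<bar>)\<^sup>2 / n\<close> in absolute value, which
  Cauchy-Schwarz bounds by the sum of squares.\<close>

lemma box_subset_elliptope:
  assumes "0 < n"
  shows "(\<Pi>\<^sub>E ij\<in>upper_indices n. {-1 / real n..1 / real n}) \<subseteq> elliptope n"
proof
  fix x assume x: "x \<in> (\<Pi>\<^sub>E ij\<in>upper_indices n. {-1 / real n..1 / real n})"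
  have "0 \<le> qform n x v" for v
  proof -
    \<comment> \<open>The product is subtracted on the diagonal too. This weakens the bound there
      but lets the double sum factor as a square.\<close>
    have lower: "(if i = j then (v i)\<^sup>2 else 0) - \<bar>v i\<bar> * \<bar>v j\<bar> / n \<le> entry x i j * v i * v j"
      if "i < n" "j < n" for i j
    proof (cases "i = j")
      case False
      then have "x (upair i j) \<in> {-1 / real n..1 / real n}"
        using x that by (intro PiE_mem[OF x]) (simp add: upair_in_upper_indices)
      then have "\<bar>x (upair i j)\<bar> * (\<bar>v i\<bar> * \<bar>v j\<bar>) \<le> (1 / n) * (\<bar>v i\<bar> * \<bar>v j\<bar>)"
        by (intro mult_right_mono) auto
      then have "\<bar>x (upair i j) * v i * v j\<bar> \<le> \<bar>v i\<bar> * \<bar>v j\<bar> / n"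
        by (simp add: abs_mult mult_ac)
      then show ?thesis
        using False by (simp add: entry_def)
    qed (simp add: entry_def power2_eq_square)
    have "(\<Sum>i<n. \<bar>v i\<bar>)\<^sup>2 \<le> n * (\<Sum>i<n. (v i)\<^sup>2)"
      using Cauchy_Schwarz_ineq_sum[of "\<lambda>_. 1" "\<lambda>i. \<bar>v i\<bar>" "{..<n}"] by simp
    then have "0 \<le> (\<Sum>i<n. (v i)\<^sup>2) - (\<Sum>i<n. \<bar>v i\<bar>)\<^sup>2 / n"
      using assms by (simp add: field_simps)
    also have "\<dots> = (\<Sum>i<n. \<Sum>j<n. (if i = j then (v i)\<^sup>2 else 0) - \<bar>v i\<bar> * \<bar>v j\<bar> / n)"
      by (simp add: sum_subtractf power2_eq_square sum_product sum_divide_distrib)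
    also have "\<dots> \<le> qform n x v"
      unfolding qform_def by (intro sum_mono lower) auto
    finally show ?thesis .
  qed
  then show "x \<in> elliptope n"
    using x by (auto simp: elliptope_def space_PiM)
qed

text \<open>The elliptope lies between two boxes of sides \<open>2 / n\<close> and \<open>2\<close>.
  Both facts are what makes the normalized measure a probability measure.\<close>

lemma emeasure_elliptope:
  assumes "0 < n"
  shows "emeasure (\<Pi>\<^sub>M ij\<in>upper_indices n. lborel) (elliptope n) \<noteq> 0" (is ?nonzero)
    and "emeasure (\<Pi>\<^sub>M ij\<in>upper_indices n. lborel) (elliptope n) \<noteq> \<infinity>" (is ?finite)
proof -
  interpret product_sigma_finite "\<lambda>_::nat \<times> nat. lborel :: real measure" by standard
  let ?M = "\<Pi>\<^sub>M ij\<in>upper_indices n. (lborel :: real measure)"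
  have box: "emeasure ?M (\<Pi>\<^sub>E ij\<in>upper_indices n. {-a..a}) = ennreal (2 * a) ^ card (upper_indices n)"
    if "0 \<le> a" for a :: real
    using that by (subst emeasure_PiM) (simp_all add: finite_upper_indices)
  have "0 < emeasure ?M (\<Pi>\<^sub>E ij\<in>upper_indices n. {-(1 / real n)..1 / real n})"
    using assms by (subst box) (auto simp: ennreal_power)
  also have "\<dots> \<le> emeasure ?M (elliptope n)"
    using box_subset_elliptope[OF assms] by (intro emeasure_mono) auto
  finally show ?nonzero by simp
  have "elliptope n \<subseteq> (\<Pi>\<^sub>E ij\<in>upper_indices n. {-1..1})"
  proof
    fix x assume x: "x \<in> elliptope n"
    then have "x ij \<in> {-1..1}" if "ij \<in> upper_indices n" for ij
      using that abs_le_1_if_elliptope[OF x] by (auto elim!: upper_indicesE simp: abs_le_iff)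
    with x show "x \<in> (\<Pi>\<^sub>E ij\<in>upper_indices n. {-1..1})"
      by (auto simp: elliptope_def space_PiM PiE_iff)
  qed
  then have "emeasure ?M (elliptope n) \<le> emeasure ?M (\<Pi>\<^sub>E ij\<in>upper_indices n. {-1..1})"
    by (intro emeasure_mono sets_PiM_I_finite finite_upper_indices) auto
  also have "\<dots> < \<infinity>"
    by (subst box) (auto simp: power_less_top_ennreal)
  finally show ?finite by simp
qed

section \<open>Integration over the elliptope\<close>

text \<open>The map acts on each coordinate separately, so the one-dimensional substitution is
  applied coordinate by coordinate, each contributing a factor \<open>\<bar>s\<bar>\<close>. The
  integrand varies in the induction because the inserted coordinate becomes a parameter.\<close>

lemma nn_integral_PiM_lborel_affine:
  fixes g :: "('i \<Rightarrow> real) \<Rightarrow> ennreal"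
  assumes "finite Q" and s: "s \<noteq> 0" and g: "g \<in> borel_measurable (\<Pi>\<^sub>M i\<in>Q. lborel)"
  shows "(\<integral>\<^sup>+y. g y \<partial>(\<Pi>\<^sub>M i\<in>Q. lborel))
    = ennreal (\<bar>s\<bar> ^ card Q) * (\<integral>\<^sup>+y. g (\<lambda>i\<in>Q. t i + s * y i) \<partial>(\<Pi>\<^sub>M i\<in>Q. lborel))"
  using assms(1) g
proof (induction Q arbitrary: g rule: finite_induct)
  case empty
  interpret product_sigma_finite "\<lambda>_::'i. lborel :: real measure" by standard
  show ?case by (subst (1 2) nn_integral_empty) (simp_all add: restrict_def)
next
  case (insert k Q)
  interpret product_sigma_finite "\<lambda>_::'i. lborel :: real measure" by standard
  note [measurable] = insert.prems
  let ?M = "\<lambda>Q. \<Pi>\<^sub>M i\<in>Q. (lborel :: real measure)"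
  interpret Q: sigma_finite_measure "?M Q"
    by (rule sigma_finite) fact
  let ?T = "\<lambda>Q y. \<lambda>i\<in>Q. t i + s * y i"
  have upd: "(?T Q y)(k := t k + s * u) = ?T (insert k Q) (y(k := u))" for y u
    using insert.hyps by (auto simp: fun_eq_iff)
  have "(\<integral>\<^sup>+y. g y \<partial>?M (insert k Q)) = (\<integral>\<^sup>+u. (\<integral>\<^sup>+y. g (y(k := u)) \<partial>?M Q) \<partial>lborel)"
    by (rule product_nn_integral_insert_rev) (use insert in auto)
  also have "\<dots> = (\<integral>\<^sup>+u. ennreal (\<bar>s\<bar> ^ card Q) * (\<integral>\<^sup>+y. g ((?T Q y)(k := u)) \<partial>?M Q) \<partial>lborel)"
    by (intro nn_integral_cong insert.IH) measurable
  also have "\<dots> = ennreal (\<bar>s\<bar> ^ card Q) * (\<integral>\<^sup>+u. (\<integral>\<^sup>+y. g ((?T Q y)(k := u)) \<partial>?M Q) \<partial>lborel)"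
    by (intro nn_integral_cmult) measurable
  also have "(\<integral>\<^sup>+u. (\<integral>\<^sup>+y. g ((?T Q y)(k := u)) \<partial>?M Q) \<partial>lborel)
     = \<bar>s\<bar> * (\<integral>\<^sup>+u. (\<integral>\<^sup>+y. g ((?T Q y)(k := t k + s * u)) \<partial>?M Q) \<partial>lborel)"
    by (rule nn_integral_real_affine[OF _ s]) measurable
  also have "(\<integral>\<^sup>+u. (\<integral>\<^sup>+y. g ((?T Q y)(k := t k + s * u)) \<partial>?M Q) \<partial>lborel)
     = (\<integral>\<^sup>+y. g (?T (insert k Q) y) \<partial>?M (insert k Q))"
    unfolding upd by (rule product_nn_integral_insert_rev[symmetric]) (use insert.hyps in \<open>simp_all\<close>, measurable)
  finally show ?case
    using insert.hyps by (simp add: ennreal_mult mult_ac restrict_def)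
qed

text \<open>The function \<open>c * sqrt (1 - c\<^sup>2) ^ (m + 2)\<close> vanishes at both
  endpoints, and its derivative is the weight minus \<open>m + 3\<close> times its product with
  \<open>c\<^sup>2\<close>. The product form of the identity avoids division in
  \<open>ennreal\<close>.\<close>

lemma nn_integral_beta_second_moment:
  defines "w \<equiv> \<lambda>m c :: real. ennreal (sqrt (1 - c\<^sup>2) ^ m) * indicator {-1..1} c"
  shows "ennreal (real m + 3) * (\<integral>\<^sup>+c. ennreal (c\<^sup>2) * w m c \<partial>lborel) = (\<integral>\<^sup>+c. w m c \<partial>lborel)"
proof -
  let ?f = "\<lambda>c :: real. sqrt (1 - c\<^sup>2) ^ m" and ?g = "\<lambda>c :: real. c\<^sup>2 * sqrt (1 - c\<^sup>2) ^ m"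
  let ?F = "\<lambda>c :: real. c * sqrt (1 - c\<^sup>2) ^ (m + 2)"
  have f: "(?f has_integral integral {-1..1} ?f) {-1..1}"
    by (intro integrable_integral integrable_continuous_interval continuous_intros)
  have g: "(?g has_integral integral {-1..1} ?g) {-1..1}"
    by (intro integrable_integral integrable_continuous_interval continuous_intros)
  have "((\<lambda>c. ?f c - (real m + 3) * ?g c) has_integral ?F 1 - ?F (-1)) {-1..1}"
  \<comment> \<open>The square root is not differentiable at \<open>c = 1\<close> and
    \<open>c = -1\<close>; continuity there is enough for this version.\<close>
  proof (rule fundamental_theorem_of_calculus_interior)
    fix c :: real assume c: "c \<in> {-1<..<1}"
    then have "0 < 1 - c\<^sup>2"
      by (simp add: power2_less_1_iff abs_square_less_1 abs_less_iff)
    then have s: "0 < sqrt (1 - c\<^sup>2)" "(sqrt (1 - c\<^sup>2))\<^sup>2 = 1 - c\<^sup>2"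
      by simp_all
    have "((\<lambda>c. sqrt (1 - c\<^sup>2)) has_real_derivative - c / sqrt (1 - c\<^sup>2)) (at c)"
      using s(1) by (auto intro!: derivative_eq_intros simp: field_simps)
    from DERIV_mult[OF DERIV_ident DERIV_power[OF this, of "m + 2"]]
    have "(?F has_real_derivative
        sqrt (1 - c\<^sup>2) ^ (m + 2) + c * ((m + 2) * sqrt (1 - c\<^sup>2) ^ (m + 1) * (- c / sqrt (1 - c\<^sup>2)))) (at c)"
      by (simp add: algebra_simps)
    also have "sqrt (1 - c\<^sup>2) ^ (m + 2) + c * ((m + 2) * sqrt (1 - c\<^sup>2) ^ (m + 1) * (- c / sqrt (1 - c\<^sup>2)))
        = ?f c - (real m + 3) * ?g c"
    proof -
      have top: "sqrt (1 - c\<^sup>2) ^ (m + 1) * (- c / sqrt (1 - c\<^sup>2)) = - c * ?f c"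
      proof -
        have "r ^ (m + 1) * (- c / r) = - c * r ^ m" if "0 < r" for r :: real
          using that by simp
        from this[OF s(1)] show ?thesis .
      qed
      have "sqrt (1 - c\<^sup>2) ^ (m + 2) = (1 - c\<^sup>2) * ?f c"
        by (simp only: power_add s(2) mult.commute)
      with top have "sqrt (1 - c\<^sup>2) ^ (m + 2)
          + c * (real (m + 2) * sqrt (1 - c\<^sup>2) ^ (m + 1) * (- c / sqrt (1 - c\<^sup>2)))
          = (1 - c\<^sup>2) * ?f c + c * (real (m + 2) * (- c * ?f c))"
        by (simp only: mult.assoc)
      moreover have "(1 - c\<^sup>2) * a + c * (real (m + 2) * (- c * a)) = a - (real m + 3) * (c\<^sup>2 * a)"
        for a
        by (simp add: algebra_simps power2_eq_square)
      ultimately show ?thesis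
        by (simp only:)
    qed
    finally show "(?F has_vector_derivative ?f c - (real m + 3) * ?g c) (at c)"
      by (simp add: has_real_derivative_iff_has_vector_derivative)
  qed (auto intro!: continuous_intros)
  then have "((\<lambda>c. ?f c - (real m + 3) * ?g c) has_integral 0) {-1..1}"
    by simp
  moreover have "((\<lambda>c. ?f c - (real m + 3) * ?g c) has_integral
      integral {-1..1} ?f - (real m + 3) * integral {-1..1} ?g) {-1..1}"
    by (intro has_integral_diff has_integral_mult_right f g)
  ultimately have "0 = integral {-1..1} ?f - (real m + 3) * integral {-1..1} ?g"
    by (rule has_integral_unique)
  then have eq: "integral {-1..1} ?f = (real m + 3) * integral {-1..1} ?g"
    by (simp only: right_minus_eq eq_commute)
  have nonneg: "0 \<le> ?f c" if "c \<in> {-1..1}" for c :: real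
    using that by (simp add: abs_square_le_1 abs_le_iff)
  have "(\<integral>\<^sup>+c. w m c \<partial>lborel) = ennreal (integral {-1..1} ?f)"
    unfolding w_def by (rule nn_integral_has_integral_lebesgue'[OF nonneg f])
  moreover have "(\<integral>\<^sup>+c. ennreal (c\<^sup>2) * w m c \<partial>lborel) = (\<integral>\<^sup>+c. ennreal (?g c) * indicator {-1..1} c \<partial>lborel)"
    unfolding w_def
    by (intro nn_integral_cong) (auto simp: ennreal_mult nonneg split: split_indicator)
  moreover have "\<dots> = ennreal (integral {-1..1} ?g)"
    by (rule nn_integral_has_integral_lebesgue'[OF _ g]) (use nonneg in simp)
  ultimately show ?thesis
    using eq by (simp add: ennreal_mult')
qed

text \<open>For \<open>s \<noteq> 0\<close> the shear is a bijection of test vectors, so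
  nonnegativity passes in both directions.\<close>

lemma elliptope_shear_iff:
  assumes pq: "p < n" "q < n" "p \<noteq> q" and s: "s\<^sup>2 = 1 - c\<^sup>2" "s \<noteq> 0"
    and x: "x \<in> space (\<Pi>\<^sub>M ij\<in>upper_indices n. lborel)" "x (upair p q) = c"
    and y: "y \<in> space (\<Pi>\<^sub>M ij\<in>upper_indices n. lborel)" "y (upair p q) = 0"
    and rest: "\<And>i j. i < n \<Longrightarrow> j < n \<Longrightarrow> i \<noteq> q \<Longrightarrow> j \<noteq> q \<Longrightarrow> i \<noteq> j \<Longrightarrow>
                 x (upair i j) = y (upair i j)"
    and x_q: "\<And>k. k < n \<Longrightarrow> k \<noteq> p \<Longrightarrow> k \<noteq> q \<Longrightarrow>
                 x (upair q k) = c * y (upair p k) + s * y (upair q k)"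
  shows "x \<in> elliptope n \<longleftrightarrow> y \<in> elliptope n"
proof -
  have shear: "qform n x v = qform n y (v(p := v p + c * v q, q := s * v q))" for v
    by (rule qform_shear[where x = x and y = y, OF pq s(1) x(2) y(2)]) (use pq rest x_q in auto)
  \<comment> \<open>The argument on the right is the image of \<open>u\<close> under the inverse
    shear.\<close>
  have "qform n y u = qform n x (u(p := u p - c * (u q / s), q := u q / s))" for u
    unfolding shear using pq s(2) by (intro arg_cong[of _ _ "qform n y"]) (auto simp: fun_eq_iff)
  with shear have "(\<forall>v. 0 \<le> qform n x v) \<longleftrightarrow> (\<forall>v. 0 \<le> qform n y v)"
    by metis
  then show ?thesis
    using x(1) y(1) by (simp add: elliptope_def)
qed

text \<open>Fubini separates the coordinate \<open>upair p q\<close>. At a fixed value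
  \<open>c\<close> the shear carries the slice at \<open>0\<close> to the slice at \<open>c\<close>;
  it scales the other \<open>n - 2\<close> coordinates of row \<open>q\<close> and leaves
  \<open>\<psi>\<close> alone, since \<open>\<psi>\<close> ignores that row. With
  \<open>\<psi> = 1\<close> this gives the density of the entry, and with general
  \<open>\<psi>\<close> its independence of the entries outside row \<open>q\<close>.\<close>

lemma nn_integral_elliptope_factor:
  fixes \<phi> :: "real \<Rightarrow> ennreal" and \<psi> :: "(nat \<times> nat \<Rightarrow> real) \<Rightarrow> ennreal"
  assumes pq: "p < n" "q < n" "p \<noteq> q"
    and \<phi>[measurable]: "\<phi> \<in> borel_measurable borel"
    and \<psi>[measurable]: "\<psi> \<in> borel_measurable (\<Pi>\<^sub>M ij\<in>upper_indices n. lborel)"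
    and \<psi>_cong: "\<And>x y. (\<And>i j. i < n \<Longrightarrow> j < n \<Longrightarrow> i \<noteq> q \<Longrightarrow> j \<noteq> q \<Longrightarrow> i \<noteq> j \<Longrightarrow>
                     x (upair i j) = y (upair i j)) \<Longrightarrow> \<psi> x = \<psi> y"
  defines "N \<equiv> \<Pi>\<^sub>M ij\<in>upper_indices n - {upair p q}. lborel"
  shows "(\<integral>\<^sup>+x. \<phi> (x (upair p q)) * \<psi> x * indicator (elliptope n) x \<partial>(\<Pi>\<^sub>M ij\<in>upper_indices n. lborel))
    = (\<integral>\<^sup>+c. \<phi> c * (ennreal (sqrt (1 - c\<^sup>2) ^ (n - 2)) * indicator {-1..1} c) \<partial>lborel)
      * (\<integral>\<^sup>+z. \<psi> (z(upair p q := 0)) * indicator (elliptope n) (z(upair p q := 0)) \<partial>N)"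
proof -
  interpret product_sigma_finite "\<lambda>_::nat \<times> nat. lborel :: real measure" by standard
  let ?M = "\<lambda>A. \<Pi>\<^sub>M ij\<in>A. (lborel :: real measure)"
  define e where "e = upair p q"
  define K where "K = {..<n} - {p, q}"
  \<comment> \<open>\<open>Q\<close> holds the coordinates that the shear moves, \<open>R\<close>
    those it fixes; row \<open>p\<close> without \<open>e\<close> lies in \<open>R\<close>.\<close>
  define Q where "Q = upair q ` K"
  define R where "R = upper_indices n - insert e Q"
  have e: "e \<in> upper_indices n" and Q: "Q \<subseteq> upper_indices n" "finite Q" "e \<notin> Q"
    using pq by (auto simp: e_def Q_def K_def upair_in_upper_indices upair_eq_iff)
  have RQ: "R \<inter> Q = {}" "finite R" "e \<notin> R \<union> Q" "insert e (R \<union> Q) = upper_indices n"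
    "upper_indices n - {e} = R \<union> Q"
    using e Q by (auto simp: R_def finite_upper_indices)
  have R: "upair i j \<in> R" if "i < n" "j < n" "i \<noteq> q" "j \<noteq> q" "i \<noteq> j" for i j
    using that by (auto simp: R_def Q_def e_def upair_in_upper_indices upair_eq_iff)
  have "inj_on (upair q) K"
    by (auto simp: inj_on_def upair_eq_iff)
  then have card_Q: "card Q = n - 2"
    using pq by (simp add: Q_def card_image K_def)
  interpret Q: sigma_finite_measure "?M Q"
    by (rule sigma_finite) (rule Q)
  interpret RQ: sigma_finite_measure "?M (R \<union> Q)"
    by (rule sigma_finite) (use RQ(2) Q(2) in simp)
  have upd: "(\<lambda>z. z(e := c)) \<in> ?M (R \<union> Q) \<rightarrow>\<^sub>M ?M (upper_indices n)" for c
    by (rule measurable_fun_upd[where J = "R \<union> Q"]) (use RQ in auto)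
  define F where "F c z = \<psi> (z(e := c)) * indicator (elliptope n) (z(e := c))" for c z
  have F[measurable]: "F c \<in> borel_measurable (?M (R \<union> Q))" for c
    unfolding F_def using measurable_compose[OF upd[of c] \<psi>]
      measurable_compose[OF upd[of c] borel_measurable_indicator[OF sets_elliptope]] by measurable
  have inner: "(\<integral>\<^sup>+z. F c z \<partial>?M (R \<union> Q))
      = ennreal (sqrt (1 - c\<^sup>2) ^ (n - 2)) * (\<integral>\<^sup>+z. F 0 z \<partial>?M (R \<union> Q))" if c: "\<bar>c\<bar> < 1" for c
  proof -
    define s where "s = sqrt (1 - c\<^sup>2)"
    have s: "s\<^sup>2 = 1 - c\<^sup>2" "s \<noteq> 0" "\<bar>s\<bar> = s"
      using c by (auto simp: s_def abs_square_less_1 less_imp_le order_less_imp_not_eq)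
    \<comment> \<open>Translates an element of \<open>Q\<close> into the coordinate of row
      \<open>p\<close> in the same column, so that the offset of the substitution can be indexed by
      \<open>Q\<close>.\<close>
    define other where "other k = upair p (if fst k = q then snd k else fst k)" for k
    have other: "other (upair q k) = upair p k" for k
      by (auto simp: other_def upair_def min_def max_def)
    have shift: "F c (merge R Q (x, \<lambda>k\<in>Q. c * x (other k) + s * y k)) = F 0 (merge R Q (x, y))"
      if x: "x \<in> space (?M R)" and y: "y \<in> space (?M Q)" for x y
    proof -
      let ?X = "(merge R Q (x, \<lambda>k\<in>Q. c * x (other k) + s * y k))(e := c)"
      let ?Y = "(merge R Q (x, y))(e := 0)"
      have off: "?X (upair i j) = ?Y (upair i j)"
        if "i < n" "j < n" "i \<noteq> q" "j \<noteq> q" "i \<noteq> j" for i j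
        using R[OF that] RQ(1,3) by (auto simp: merge_def)
      have row: "?X (upair q k) = c * ?Y (upair p k) + s * ?Y (upair q k)"
        if "k < n" "k \<noteq> p" "k \<noteq> q" for k
      proof -
        have "upair p k \<in> R" "upair q k \<in> Q"
          using that pq by (auto intro!: R simp: Q_def K_def)
        then show ?thesis
          using RQ(1,3) by (auto simp: merge_def other)
      qed
      have "?X \<in> space (?M (upper_indices n))" "?Y \<in> space (?M (upper_indices n))"
        using x y RQ(4) by (auto simp: space_PiM PiE_iff extensional_def merge_def)
      then have "?X \<in> elliptope n \<longleftrightarrow> ?Y \<in> elliptope n"
        by (intro elliptope_shear_iff[OF pq s(1,2)] off row) (simp_all add: e_def)
      moreover have "\<psi> ?X = \<psi> ?Y"
        by (rule \<psi>_cong) (rule off)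
      ultimately show ?thesis
        by (simp add: F_def indicator_def)
    qed
    have "(\<integral>\<^sup>+z. F c z \<partial>?M (R \<union> Q))
        = (\<integral>\<^sup>+x. (\<integral>\<^sup>+y. F c (merge R Q (x, y)) \<partial>?M Q) \<partial>?M R)"
      by (rule product_nn_integral_fold) (use RQ(1-3) Q(2) in simp_all)
    also have "\<dots> = (\<integral>\<^sup>+x. ennreal (s ^ (n - 2)) * (\<integral>\<^sup>+y. F 0 (merge R Q (x, y)) \<partial>?M Q) \<partial>?M R)"
    proof (intro nn_integral_cong)
      fix x assume x: "x \<in> space (?M R)"
      have "(\<lambda>y. F c (merge R Q (x, y))) \<in> borel_measurable (?M Q)"
        using x by measurable
      \<comment> \<open>Once the coordinates in \<open>R\<close> are fixed, the shear is affine in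
        those of \<open>Q\<close>, with common scale \<open>s\<close> and an offset depending only
        on \<open>x\<close>.\<close>
      from nn_integral_PiM_lborel_affine[OF Q(2) s(2) this, of "\<lambda>k. c * x (other k)"]
      have "(\<integral>\<^sup>+y. F c (merge R Q (x, y)) \<partial>?M Q) = ennreal (s ^ (n - 2))
          * (\<integral>\<^sup>+y. F c (merge R Q (x, \<lambda>k\<in>Q. c * x (other k) + s * y k)) \<partial>?M Q)"
        by (simp add: s(3) card_Q)
      also have "(\<integral>\<^sup>+y. F c (merge R Q (x, \<lambda>k\<in>Q. c * x (other k) + s * y k)) \<partial>?M Q)
          = (\<integral>\<^sup>+y. F 0 (merge R Q (x, y)) \<partial>?M Q)"
        by (intro nn_integral_cong shift x)
      finally show "(\<integral>\<^sup>+y. F c (merge R Q (x, y)) \<partial>?M Q)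
          = ennreal (s ^ (n - 2)) * (\<integral>\<^sup>+y. F 0 (merge R Q (x, y)) \<partial>?M Q)" .
    qed
    also have "\<dots> = ennreal (s ^ (n - 2)) * (\<integral>\<^sup>+x. (\<integral>\<^sup>+y. F 0 (merge R Q (x, y)) \<partial>?M Q) \<partial>?M R)"
      by (rule nn_integral_cmult) measurable
    also have "(\<integral>\<^sup>+x. (\<integral>\<^sup>+y. F 0 (merge R Q (x, y)) \<partial>?M Q) \<partial>?M R) = (\<integral>\<^sup>+z. F 0 z \<partial>?M (R \<union> Q))"
      by (rule product_nn_integral_fold[symmetric]) (use RQ(1-3) Q(2) in simp_all)
    finally show ?thesis by (simp add: s_def)
  qed
  have outer: "(\<integral>\<^sup>+z. F c z \<partial>?M (R \<union> Q)) = 0" if "1 < \<bar>c\<bar>" for c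
  proof -
    have "F c z = 0" for z
      using abs_le_1_if_elliptope[of "z(e := c)" n p q] pq that
      by (auto simp: F_def e_def indicator_def)
    then show ?thesis by simp
  qed
  let ?f = "\<lambda>x. \<phi> (x e) * \<psi> x * indicator (elliptope n) x"
  have "(\<lambda>x. \<phi> (x e)) \<in> borel_measurable (?M (upper_indices n))"
    using measurable_component_singleton[OF e, of "\<lambda>_. lborel"]
    by (intro measurable_compose[OF _ \<phi>]) simp
  then have "?f \<in> borel_measurable (?M (upper_indices n))"
    by measurable
  then have f: "?f \<in> borel_measurable (?M (insert e (R \<union> Q)))"
    unfolding RQ(4) .
  have "(\<integral>\<^sup>+x. ?f x \<partial>?M (insert e (R \<union> Q))) = (\<integral>\<^sup>+c. (\<integral>\<^sup>+z. ?f (z(e := c)) \<partial>?M (R \<union> Q)) \<partial>lborel)"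
    by (rule product_nn_integral_insert_rev[OF _ _ f]) (use RQ(1-3) Q(2) in simp_all)
  also have "\<dots> = (\<integral>\<^sup>+c. \<phi> c * (\<integral>\<^sup>+z. F c z \<partial>?M (R \<union> Q)) \<partial>lborel)"
    by (intro nn_integral_cong) (subst nn_integral_cmult[OF F, symmetric], simp add: F_def mult.assoc)
  also have "\<dots> = (\<integral>\<^sup>+c. \<phi> c * (ennreal (sqrt (1 - c\<^sup>2) ^ (n - 2)) * indicator {-1..1} c)
      * (\<integral>\<^sup>+z. F 0 z \<partial>?M (R \<union> Q)) \<partial>lborel)"
  proof (rule nn_integral_cong_AE)
    show "AE c in lborel. \<phi> c * (\<integral>\<^sup>+z. F c z \<partial>?M (R \<union> Q))
        = \<phi> c * (ennreal (sqrt (1 - c\<^sup>2) ^ (n - 2)) * indicator {-1..1} c)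
          * (\<integral>\<^sup>+z. F 0 z \<partial>?M (R \<union> Q))"
      \<comment> \<open>At \<open>c = 1\<close> and \<open>c = -1\<close> the shear degenerates
        because \<open>s = 0\<close>; these two values form a null set.\<close>
      using AE_lborel_singleton[of "1 :: real"] AE_lborel_singleton[of "-1 :: real"]
    proof eventually_elim
      case (elim c)
      show ?case
      proof (cases "\<bar>c\<bar> < 1")
        case True
        then show ?thesis
          by (subst inner) (auto simp: abs_less_iff mult.assoc)
      next
        case False
        with elim have "1 < \<bar>c\<bar>" by auto
        then show ?thesis
          by (auto simp: outer indicator_def)
      qed
    qed
  qed
  also have "\<dots> = (\<integral>\<^sup>+c. \<phi> c * (ennreal (sqrt (1 - c\<^sup>2) ^ (n - 2)) * indicator {-1..1} c) \<partial>lborel)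
      * (\<integral>\<^sup>+z. F 0 z \<partial>?M (R \<union> Q))"
    by (rule nn_integral_multc) measurable
  finally show ?thesis
    unfolding F_def N_def RQ(4,5) e_def[symmetric] .
qed

text \<open>Factoring with \<open>\<phi>\<close> the square and with \<open>\<phi> = 1\<close>
  leaves the same factor \<open>G\<close>, so only the two one-dimensional integrals are
  compared.\<close>

lemma nn_integral_elliptope_second_moment:
  fixes \<psi> :: "(nat \<times> nat \<Rightarrow> real) \<Rightarrow> ennreal"
  assumes pq: "p < n" "q < n" "p \<noteq> q"
    and \<psi>[measurable]: "\<psi> \<in> borel_measurable (\<Pi>\<^sub>M ij\<in>upper_indices n. lborel)"
    and \<psi>_cong: "\<And>x y. (\<And>i j. i < n \<Longrightarrow> j < n \<Longrightarrow> i \<noteq> q \<Longrightarrow> j \<noteq> q \<Longrightarrow> i \<noteq> j \<Longrightarrow>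
                     x (upair i j) = y (upair i j)) \<Longrightarrow> \<psi> x = \<psi> y"
  defines "M \<equiv> \<Pi>\<^sub>M ij\<in>upper_indices n. lborel"
  shows "ennreal (real n + 1) * (\<integral>\<^sup>+x. ennreal ((x (upair p q))\<^sup>2) * \<psi> x * indicator (elliptope n) x \<partial>M)
    = (\<integral>\<^sup>+x. \<psi> x * indicator (elliptope n) x \<partial>M)"
proof -
  note factor = nn_integral_elliptope_factor[OF pq _ \<psi> \<psi>_cong, folded M_def]
  define w where "w c = ennreal (sqrt (1 - c\<^sup>2) ^ (n - 2)) * indicator {-1..1} c" for c :: real
  define G where "G = (\<integral>\<^sup>+z. \<psi> (z(upair p q := 0)) * indicator (elliptope n) (z(upair p q := 0))
    \<partial>(\<Pi>\<^sub>M ij\<in>upper_indices n - {upair p q}. lborel))"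
  have "(\<integral>\<^sup>+x. ennreal ((x (upair p q))\<^sup>2) * \<psi> x * indicator (elliptope n) x \<partial>M)
      = (\<integral>\<^sup>+c. ennreal (c\<^sup>2) * w c \<partial>lborel) * G"
    unfolding w_def G_def by (rule factor) simp_all
  moreover have "(\<integral>\<^sup>+x. \<psi> x * indicator (elliptope n) x \<partial>M) = (\<integral>\<^sup>+c. w c \<partial>lborel) * G"
    using factor[of "\<lambda>_. 1"] unfolding w_def G_def mult_1 by simp
  moreover have "ennreal (real n + 1) * (\<integral>\<^sup>+c. ennreal (c\<^sup>2) * w c \<partial>lborel) = (\<integral>\<^sup>+c. w c \<partial>lborel)"
  proof -
    \<comment> \<open>Distinct \<open>p\<close> and \<open>q\<close> below \<open>n\<close> force
      \<open>n \<ge> 2\<close>, so the subtraction does not truncate.\<close>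
    have "real (n - 2) + 3 = real n + 1" using pq by linarith
    then show ?thesis
      using nn_integral_beta_second_moment[of "n - 2"] by (simp only: w_def)
  qed
  ultimately show ?thesis
    by (metis mult.assoc)
qed

section \<open>Moments under the uniform distribution\<close>

text \<open>Coordinate version of \<open>uniform_correlation\<close>; the two are linked by
  \<open>uniform_correlation_eq_distr\<close>.\<close>

definition uniform_elliptope :: "nat \<Rightarrow> (nat \<times> nat \<Rightarrow> real) measure" where
  "uniform_elliptope n = uniform_measure (\<Pi>\<^sub>M ij\<in>upper_indices n. lborel) (elliptope n)"

lemma sets_uniform_elliptope [measurable_cong]:
  "sets (uniform_elliptope n) = sets (\<Pi>\<^sub>M ij\<in>upper_indices n. lborel)"
  and space_uniform_elliptope: "space (uniform_elliptope n) = space (\<Pi>\<^sub>M ij\<in>upper_indices n. lborel)"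
  by (simp_all add: uniform_elliptope_def)

lemma prob_space_uniform_elliptope:
  assumes "0 < n"
  shows "prob_space (uniform_elliptope n)"
  unfolding uniform_elliptope_def by (intro prob_space_uniform_measure emeasure_elliptope assms)

lemma measurable_entry_uniform_elliptope:
  assumes "e \<in> upper_indices n"
  shows "(\<lambda>x. x e) \<in> borel_measurable (uniform_elliptope n)"
proof -
  have "(\<lambda>x. x e) \<in> borel_measurable (\<Pi>\<^sub>M ij\<in>upper_indices n. lborel)"
    using measurable_component_singleton[OF assms, of "\<lambda>_. lborel"] by simp
  then show ?thesis
    by measurable
qed

lemma AE_uniform_elliptope_abs_le_1:
  assumes "e \<in> upper_indices n"
  shows "AE x in uniform_elliptope n. \<bar>x e\<bar> \<le> 1"
  unfolding uniform_elliptope_def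
proof (rule AE_uniform_measureI)
  show "AE x in \<Pi>\<^sub>M ij\<in>upper_indices n. lborel. x \<in> elliptope n \<longrightarrow> \<bar>x e\<bar> \<le> 1"
    using assms by (auto elim!: upper_indicesE intro: abs_le_1_if_elliptope)
qed simp

lemma nn_integral_uniform_elliptope_second_moment:
  assumes "p < n" "q < n" "p \<noteq> q"
    and \<psi>[measurable]: "\<psi> \<in> borel_measurable (\<Pi>\<^sub>M ij\<in>upper_indices n. lborel)"
    and \<psi>_cong: "\<And>x y. (\<And>i j. i < n \<Longrightarrow> j < n \<Longrightarrow> i \<noteq> q \<Longrightarrow> j \<noteq> q \<Longrightarrow> i \<noteq> j \<Longrightarrow>
                     x (upair i j) = y (upair i j)) \<Longrightarrow> \<psi> x = \<psi> y"
  shows "ennreal (real n + 1) * (\<integral>\<^sup>+x. ennreal ((x (upair p q))\<^sup>2) * \<psi> x \<partial>uniform_elliptope n)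
    = (\<integral>\<^sup>+x. \<psi> x \<partial>uniform_elliptope n)"
proof -
  have "upair p q \<in> upper_indices n"
    using assms by (simp add: upair_in_upper_indices)
  then have "(\<lambda>x. x (upair p q)) \<in> borel_measurable (\<Pi>\<^sub>M ij\<in>upper_indices n. lborel)"
    using measurable_component_singleton[of "upair p q" _ "\<lambda>_. lborel"] by simp
  then have "(\<lambda>x. ennreal ((x (upair p q))\<^sup>2)) \<in> borel_measurable (\<Pi>\<^sub>M ij\<in>upper_indices n. lborel)"
    by (intro measurable_compose[OF _ measurable_ennreal] borel_measurable_power)
  then have "(\<lambda>x. ennreal ((x (upair p q))\<^sup>2) * \<psi> x) \<in> borel_measurable (\<Pi>\<^sub>M ij\<in>upper_indices n. lborel)"
    by measurable
  moreover have "ennreal (real n + 1)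
      * (\<integral>\<^sup>+x. ennreal ((x (upair p q))\<^sup>2) * \<psi> x * indicator (elliptope n) x \<partial>(\<Pi>\<^sub>M ij\<in>upper_indices n. lborel))
      = (\<integral>\<^sup>+x. \<psi> x * indicator (elliptope n) x \<partial>(\<Pi>\<^sub>M ij\<in>upper_indices n. lborel))"
    by (rule nn_integral_elliptope_second_moment[OF assms(1-3) \<psi> \<psi>_cong]) simp
  ultimately show ?thesis
    unfolding uniform_elliptope_def
    by (simp only: nn_integral_uniform_measure sets_elliptope \<psi> ennreal_times_divide)
qed

lemma nn_integral_uniform_elliptope_square:
  assumes "e \<in> upper_indices n"
  shows "(\<integral>\<^sup>+x. ennreal ((x e)\<^sup>2) \<partial>uniform_elliptope n) = ennreal (1 / (real n + 1))"
proof -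
  obtain p q where e: "e = upair p q" and pq: "p < n" "q < n" "p \<noteq> q"
    using assms by (rule upper_indicesE)
  interpret prob_space "uniform_elliptope n"
    using pq by (intro prob_space_uniform_elliptope) simp
  let ?I = "\<integral>\<^sup>+x. ennreal ((x e)\<^sup>2) \<partial>uniform_elliptope n"
  have "ennreal (real n + 1) * ?I = 1"
    using nn_integral_uniform_elliptope_second_moment[OF pq, of "\<lambda>_. 1"]
    by (simp add: e emeasure_space_1)
  \<comment> \<open>Multiplying by the reciprocal stands in for cancellation in
    \<open>ennreal\<close>.\<close>
  then have "ennreal (1 / (real n + 1)) * (ennreal (real n + 1) * ?I) = ennreal (1 / (real n + 1))"
    by simp
  moreover have "ennreal (1 / (real n + 1)) * ennreal (real n + 1) = 1"
    by (subst ennreal_mult[symmetric]) auto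
  ultimately show ?thesis
    by (simp add: mult.assoc[symmetric])
qed

text \<open>Some endpoint of \<open>e\<close> is not an endpoint of \<open>f\<close>. Taking it as
  the sheared row \<open>q\<close> makes \<open>(x f)\<^sup>2\<close> an admissible
  \<open>\<psi>\<close>, and the product of the two means results.\<close>

lemma nn_integral_uniform_elliptope_squares:
  assumes ef: "e \<in> upper_indices n" "f \<in> upper_indices n" "e \<noteq> f"
  shows "(\<integral>\<^sup>+x. ennreal ((x e)\<^sup>2) * ennreal ((x f)\<^sup>2) \<partial>uniform_elliptope n)
    = ennreal ((1 / (real n + 1))\<^sup>2)"
proof -
  obtain i j where ij: "e = upair i j" "i < n" "j < n" "i \<noteq> j"
    using ef(1) by (rule upper_indicesE)
  obtain k l where kl: "f = upair k l" "k < n" "l < n" "k \<noteq> l"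
    using ef(2) by (rule upper_indicesE)
  \<comment> \<open>Otherwise both pairs would have the same two endpoints and coincide.\<close>
  have "i \<notin> {k, l} \<or> j \<notin> {k, l}"
    using ij kl ef(3) by (auto simp: upair_commute)
  then obtain p q where e: "e = upair p q" and pq: "p < n" "q < n" "p \<noteq> q" and q: "q \<notin> {k, l}"
    using ij by (metis upair_commute)
  let ?I = "\<integral>\<^sup>+x. ennreal ((x e)\<^sup>2) * ennreal ((x f)\<^sup>2) \<partial>uniform_elliptope n"
  have "(\<lambda>x. x f) \<in> borel_measurable (\<Pi>\<^sub>M ij\<in>upper_indices n. lborel)"
    using measurable_component_singleton[OF ef(2), of "\<lambda>_. lborel"] by simp
  then have "(\<lambda>x. ennreal ((x f)\<^sup>2)) \<in> borel_measurable (\<Pi>\<^sub>M ij\<in>upper_indices n. lborel)"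
    by (intro measurable_compose[OF _ measurable_ennreal] borel_measurable_power)
  then have "ennreal (real n + 1) * ?I = (\<integral>\<^sup>+x. ennreal ((x f)\<^sup>2) \<partial>uniform_elliptope n)"
    unfolding e
    by (rule nn_integral_uniform_elliptope_second_moment[OF pq]) (use kl q in auto)
  also have "\<dots> = ennreal (1 / (real n + 1))"
    by (rule nn_integral_uniform_elliptope_square[OF ef(2)])
  finally have "ennreal (1 / (real n + 1)) * (ennreal (real n + 1) * ?I) = ennreal ((1 / (real n + 1))\<^sup>2)"
    by (simp add: power2_eq_square ennreal_mult[symmetric])
  moreover have "ennreal (1 / (real n + 1)) * ennreal (real n + 1) = 1"
    by (subst ennreal_mult[symmetric]) auto
  ultimately show ?thesis
    by (simp add: mult.assoc[symmetric])
qed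

text \<open>Without covariances the variance is the sum of the individual variances, and for values
  in \<open>[0, 1]\<close> each second moment is at most the mean.\<close>

lemma (in prob_space) variance_sum_uncorrelated_le:
  fixes Y :: "'i \<Rightarrow> 'a \<Rightarrow> real" and \<mu> :: real
  assumes "finite I"
    and Y: "\<And>i. i \<in> I \<Longrightarrow> random_variable borel (Y i)"
    and bound: "\<And>i. i \<in> I \<Longrightarrow> AE x in M. 0 \<le> Y i x \<and> Y i x \<le> 1"
    and mean: "\<And>i. i \<in> I \<Longrightarrow> expectation (Y i) = \<mu>"
    and cov: "\<And>i j. i \<in> I \<Longrightarrow> j \<in> I \<Longrightarrow> i \<noteq> j \<Longrightarrow> expectation (\<lambda>x. Y i x * Y j x) = \<mu>\<^sup>2"
  defines "Z \<equiv> \<lambda>x. \<Sum>i\<in>I. Y i x"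
  shows "integrable M (\<lambda>x. (Z x)\<^sup>2)" "expectation Z = card I * \<mu>" "variance Z \<le> card I * \<mu>"
proof -
  have int: "integrable M (Y i)" if "i \<in> I" for i
    using bound[OF that] by (intro integrable_const_bound[where B = 1] Y that) auto
  have int2: "integrable M (\<lambda>x. Y i x * Y j x)" if "i \<in> I" "j \<in> I" for i j
  proof (rule integrable_const_bound[where B = 1])
    show "AE x in M. norm (Y i x * Y j x) \<le> 1"
      using bound[OF that(1)] bound[OF that(2)] by eventually_elim (auto intro: mult_le_one)
  qed (intro borel_measurable_times Y that)
  have Z2: "(Z x)\<^sup>2 = (\<Sum>i\<in>I. \<Sum>j\<in>I. Y i x * Y j x)" for x
    by (simp add: Z_def power2_eq_square sum_product)
  show int_Z2: "integrable M (\<lambda>x. (Z x)\<^sup>2)"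
    unfolding Z2 by (intro Bochner_Integration.integrable_sum int2)
  have int_Z: "integrable M Z"
    unfolding Z_def by (intro Bochner_Integration.integrable_sum int)
  show E_Z: "expectation Z = card I * \<mu>"
    unfolding Z_def by (subst Bochner_Integration.integral_sum) (simp_all add: int mean)
  \<comment> \<open>The slack \<open>\<mu>\<^sup>2\<close> on the diagonal completes the double sum
    to \<open>(card I * \<mu>)\<^sup>2\<close>, which the squared mean then cancels.\<close>
  have prod_le: "expectation (\<lambda>x. Y i x * Y j x) \<le> \<mu>\<^sup>2 + (if i = j then \<mu> else 0)"
    if "i \<in> I" "j \<in> I" for i j
  proof (cases "i = j")
    case True
    have "expectation (\<lambda>x. Y i x * Y i x) \<le> expectation (Y i)"
      using bound[OF that(1)]
      by (intro integral_mono_AE int int2 that, eventually_elim) (auto intro: mult_left_le)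
    also have "\<dots> \<le> \<mu>\<^sup>2 + \<mu>"
      by (simp add: mean that)
    finally show ?thesis
      using True by simp
  qed (simp add: cov that)
  have "expectation (\<lambda>x. (Z x)\<^sup>2) = (\<Sum>i\<in>I. \<Sum>j\<in>I. expectation (\<lambda>x. Y i x * Y j x))"
    unfolding Z2
    by (simp add: Bochner_Integration.integral_sum Bochner_Integration.integrable_sum int2)
  also have "\<dots> \<le> (\<Sum>i\<in>I. \<Sum>j\<in>I. \<mu>\<^sup>2 + (if i = j then \<mu> else 0))"
    by (intro sum_mono prod_le)
  also have "\<dots> = (card I * \<mu>)\<^sup>2 + card I * \<mu>"
    using assms(1) by (simp add: sum.distrib power2_eq_square algebra_simps)
  finally show "variance Z \<le> card I * \<mu>"
    by (subst variance_eq[OF int_Z int_Z2]) (simp add: E_Z)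
qed

lemma uniform_elliptope_sum_squares:
  fixes n :: nat
  assumes "0 < n"
  defines "Z \<equiv> \<lambda>x. \<Sum>e\<in>upper_indices n. (x e)\<^sup>2" and "N \<equiv> uniform_elliptope n"
  shows "Z \<in> borel_measurable N" "integrable N (\<lambda>x. (Z x)\<^sup>2)"
    and "prob_space.expectation N Z = card (upper_indices n) / (real n + 1)"
    and "prob_space.variance N Z \<le> card (upper_indices n) / (real n + 1)"
proof -
  interpret prob_space N
    unfolding N_def by (rule prob_space_uniform_elliptope) fact
  let ?Y = "\<lambda>(e :: nat \<times> nat) x. (x e :: real)\<^sup>2"
  have Y: "random_variable borel (?Y e)" if "e \<in> upper_indices n" for e
    unfolding N_def by (intro borel_measurable_power measurable_entry_uniform_elliptope that)
  then show "Z \<in> borel_measurable N"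
    unfolding Z_def by (intro borel_measurable_sum)
  have bound: "AE x in N. 0 \<le> ?Y e x \<and> ?Y e x \<le> 1" if "e \<in> upper_indices n" for e
    using AE_uniform_elliptope_abs_le_1[OF that] unfolding N_def
    by eventually_elim (simp add: abs_square_le_1)
  have mean: "expectation (?Y e) = 1 / (real n + 1)" if "e \<in> upper_indices n" for e
    using nn_integral_uniform_elliptope_square[OF that]
    by (subst integral_eq_nn_integral) (simp_all add: Y that N_def[symmetric])
  have cov: "expectation (\<lambda>x. ?Y e x * ?Y f x) = (1 / (real n + 1))\<^sup>2"
    if "e \<in> upper_indices n" "f \<in> upper_indices n" "e \<noteq> f" for e f
  proof -
    have "random_variable borel (\<lambda>x. ?Y e x * ?Y f x)"
      by (intro borel_measurable_times Y that)
    then show ?thesis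
      using nn_integral_uniform_elliptope_squares[OF that]
      by (subst integral_eq_nn_integral) (simp_all add: N_def[symmetric] ennreal_mult)
  qed
  note moments = variance_sum_uncorrelated_le[of "upper_indices n" ?Y, OF finite_upper_indices Y bound mean cov]
  show "integrable N (\<lambda>x. (Z x)\<^sup>2)" "expectation Z = card (upper_indices n) / (real n + 1)"
    "variance Z \<le> card (upper_indices n) / (real n + 1)"
    using moments unfolding Z_def by simp_all
qed

section \<open>Passage from coordinates to matrices\<close>

lemma index_unit_diag_mat:
  "i < n \<Longrightarrow> j < n \<Longrightarrow> unit_diag_mat n x $$ (i, j) = entry x i j"
  by (auto simp: unit_diag_mat_def entry_def upair_def)

lemma unit_diag_mat_in_correlation_matrices:
  "unit_diag_mat n x \<in> correlation_matrices n \<longleftrightarrow> (\<forall>v. 0 \<le> qform n x v)"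
proof -
  let ?C = "unit_diag_mat n x"
  have C: "?C \<in> carrier_mat n n"
    by (simp add: unit_diag_mat_def)
  have form: "v \<bullet> (?C *\<^sub>v v) = qform n x (vec_index v)" if "v \<in> carrier_vec n" for v
    using C that
    by (auto simp: scalar_prod_def qform_def row_def atLeast0LessThan sum_distrib_left index_unit_diag_mat
        mult_ac intro!: sum.cong)
  \<comment> \<open>Truncating a total function to a vector of dimension \<open>n\<close> does not
    change the form, so quantifying over carrier vectors and over functions is equivalent.\<close>
  have vec: "qform n x (vec_index (Matrix.vec n v)) = qform n x v" for v
    by (auto simp: qform_def intro!: sum.cong)
  have "pos_semidef ?C \<longleftrightarrow> (\<forall>v \<in> carrier_vec n. 0 \<le> qform n x (vec_index v))"
    using C by (simp add: pos_semidef_def form)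
  also have "\<dots> \<longleftrightarrow> (\<forall>v. 0 \<le> qform n x v)"
    by (metis vec vec_carrier)
  finally have "pos_semidef ?C \<longleftrightarrow> (\<forall>v. 0 \<le> qform n x v)" .
  moreover have "?C = transpose_mat ?C"
    using C by (intro eq_matI) (auto simp: index_unit_diag_mat entry_commute)
  moreover have "?C $$ (i, i) = 1" if "i < n" for i
    using that by (simp add: index_unit_diag_mat entry_def)
  ultimately show ?thesis
    using C by (simp add: correlation_matrices_def)
qed

lemma frobenius_norm_unit_diag_mat:
  "(frobenius_norm (unit_diag_mat n x - 1\<^sub>m n))\<^sup>2 = 2 * (\<Sum>e\<in>upper_indices n. (x e)\<^sup>2)"
proof -
  have "(frobenius_norm (unit_diag_mat n x - 1\<^sub>m n))\<^sup>2
      = (\<Sum>i<n. \<Sum>j<n. (if i = j then 0 else x (upair i j))\<^sup>2)"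
    unfolding frobenius_norm_def
    by (subst real_sqrt_pow2) 
      (auto simp: sum_nonneg index_unit_diag_mat entry_def unit_diag_mat_def upair_def intro!: sum.cong)
  also have "\<dots> = 2 * (\<Sum>(i, j)\<in>upper_indices n. (if i = j then 0 else x (upair i j))\<^sup>2)"
    by (subst sum_square_symmetric) (simp_all add: upair_commute)
  also have "(\<Sum>(i, j)\<in>upper_indices n. (if i = j then 0 else x (upair i j))\<^sup>2)
      = (\<Sum>e\<in>upper_indices n. (x e)\<^sup>2)"
    by (intro sum.cong) (auto simp: upper_indices_def upair_def)
  finally show ?thesis .
qed

lemma measurable_unit_diag_mat:
  "unit_diag_mat n \<in> (\<Pi>\<^sub>M ij\<in>upper_indices n. lborel) \<rightarrow>\<^sub>M unit_diag_lebesgue n"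
  unfolding unit_diag_lebesgue_def by (rule measurable_embed_measure2'[OF inj_on_unit_diag_mat])

text \<open>Embedding along an injective map is a push-forward, and a density on the image pulls
  back to the composed density. The pulled-back indicator is that of the elliptope, and the two
  volumes agree.\<close>

lemma uniform_correlation_eq_distr:
  "uniform_correlation n = distr (uniform_elliptope n) (unit_diag_lebesgue n) (unit_diag_mat n)"
proof -
  let ?M = "\<Pi>\<^sub>M ij\<in>upper_indices n. (lborel :: real measure)"
  let ?L = "unit_diag_lebesgue n" and ?S = "correlation_matrices n" and ?u = "unit_diag_mat n"
  have vimage: "?u -` ?S \<inter> space ?M = elliptope n"
    by (auto simp: elliptope_def unit_diag_mat_in_correlation_matrices)
  have "?S \<subseteq> space ?L"
    by (auto simp: space_unit_diag_lebesgue correlation_matrices_def)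
  also have "space ?L = ?u ` space ?M"
    by (simp add: unit_diag_lebesgue_def space_embed_measure)
  \<comment> \<open>Measurable sets of the embedded measure arise as images, so the set is exhibited
    as the image of a measurable one.\<close>
  finally have "?S = ?u ` elliptope n"
    unfolding vimage[symmetric] by auto
  then have S: "?S \<in> sets ?L"
    unfolding unit_diag_lebesgue_def by (auto intro: in_sets_embed_measure)
  have L: "?L = distr ?M ?L ?u"
    unfolding unit_diag_lebesgue_def by (rule embed_measure_eq_distr'[OF inj_on_unit_diag_mat])
  have vol: "emeasure ?L ?S = emeasure ?M (elliptope n)"
    by (subst L) (simp add: emeasure_distr measurable_unit_diag_mat S vimage)
  have "uniform_correlation n = density (distr ?M ?L ?u) (\<lambda>C. indicator ?S C / emeasure ?L ?S)"
    unfolding uniform_correlation_def uniform_measure_def using L by simp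
  also have "\<dots> = distr (density ?M (\<lambda>x. indicator ?S (?u x) / emeasure ?L ?S)) ?L ?u"
    by (rule density_distr) (use S measurable_unit_diag_mat in auto)
  also have "density ?M (\<lambda>x. indicator ?S (?u x) / emeasure ?L ?S) = uniform_elliptope n"
    unfolding uniform_elliptope_def uniform_measure_def vol
  proof (rule density_cong)
    show "(\<lambda>x. indicator ?S (?u x) / emeasure ?M (elliptope n)) \<in> borel_measurable ?M"
      using S measurable_unit_diag_mat[of n] by measurable
    show "AE x in ?M. indicator ?S (?u x) / emeasure ?M (elliptope n)
        = indicator (elliptope n) x / emeasure ?M (elliptope n)"
      using vimage by (intro AE_I2) (auto simp: indicator_def)
  qed simp
  finally show ?thesis .
qed

section \<open>Mean, its asymptotic form, and concentration\<close>

theorem proposition3: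
  fixes U :: "nat \<Rightarrow> real mat measure" and E :: "nat \<Rightarrow> real"
  defines "U \<equiv> uniform_correlation"
    and "E \<equiv> \<lambda>n. \<integral>C. (frobenius_norm (C - 1\<^sub>m n))\<^sup>2 \<partial>U n"
  shows "(\<forall>n\<ge>1. E n = real n * (real n - 1) / (real n + 1))
       \<and> (\<exists>h \<in> o(\<lambda>_. 1). \<forall>n\<ge>1. E n = real n * (1 + h n))
       \<and> (\<forall>\<epsilon>>0. (\<lambda>n. \<P>(C in U n. \<bar>(frobenius_norm (C - 1\<^sub>m n))\<^sup>2 / E n - 1\<bar> > \<epsilon>))
                    \<longlonglongrightarrow> 0)"
proof (intro conjI allI impI)
  define Z :: "nat \<Rightarrow> (nat \<times> nat \<Rightarrow> real) \<Rightarrow> real" where "Z n x = (\<Sum>e\<in>upper_indices n. (x e)\<^sup>2)" for n x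
  define g :: "nat \<Rightarrow> real mat \<Rightarrow> real" where "g n C = (frobenius_norm (C - 1\<^sub>m n))\<^sup>2" for n C
  have g: "g n (unit_diag_mat n x) = 2 * Z n x" for n x
    by (simp add: g_def Z_def frobenius_norm_unit_diag_mat)
  have u[measurable]: "unit_diag_mat n \<in> uniform_elliptope n \<rightarrow>\<^sub>M unit_diag_lebesgue n" for n
    using measurable_unit_diag_mat[of n] by measurable
  note Z = uniform_elliptope_sum_squares[folded Z_def]
  \<comment> \<open>On the embedded space it suffices to check the composition with the embedding,
    which is \<open>2 * Z n\<close>.\<close>
  have g_meas: "g n \<in> borel_measurable (unit_diag_lebesgue n)" if "0 < n" for n
    unfolding unit_diag_lebesgue_def
    using Z(1)[OF that] by (intro measurable_embed_measure1) (simp add: g measurable_cong_sets[OF sets_uniform_elliptope refl])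
  have E: "E n = real n * (real n - 1) / (real n + 1)" if "0 < n" for n
  proof -
    have "E n = (\<integral>x. 2 * Z n x \<partial>uniform_elliptope n)"
      unfolding E_def U_def uniform_correlation_eq_distr g_def[symmetric]
      by (subst integral_distr[OF u g_meas[OF that]]) (simp add: g)
    also have "\<dots> = 2 * (real n * (real n - 1) / 2 / (real n + 1))"
      by (simp only: integral_mult_right_zero Z(3)[OF that] card_upper_indices)
    also have "\<dots> = real n * (real n - 1) / (real n + 1)"
    proof -
      have "2 * (a / 2 / b) = a / b" for a b :: real by simp
      then show ?thesis .
    qed
    finally show ?thesis .
  qed
  then show "E n = real n * (real n - 1) / (real n + 1)" if "1 \<le> n" for n
    using that by simp
  show "\<exists>h \<in> o(\<lambda>_. 1). \<forall>n\<ge>1. E n = real n * (1 + h n)"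
  proof (intro bexI allI impI)
    \<comment> \<open>The witness comes from
      \<open>(n - 1) / (n + 1) = 1 - 2 / (n + 1)\<close>.\<close>
    show "(\<lambda>n. - 2 / (real n + 1)) \<in> o(\<lambda>_. 1)"
      by real_asymp
    show "E n = real n * (1 + - 2 / (real n + 1))" if "1 \<le> n" for n
      using that by (simp add: E field_simps)
  qed
  fix \<epsilon> :: real assume \<epsilon>: "0 < \<epsilon>"
  define P where "P n = \<P>(C in U n. \<bar>g n C / E n - 1\<bar> > \<epsilon>)" for n
  \<comment> \<open>The restriction to \<open>n \<ge> 2\<close> excludes \<open>E 1 = 0\<close>,
    where the ratio degenerates. The bound is \<open>2 / (\<epsilon>\<^sup>2 * E n)\<close> and
    tends to \<open>0\<close> because \<open>E n\<close> grows linearly.\<close>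
  have "P n \<le> 1 / \<epsilon>\<^sup>2 * (2 * (real n + 1) / (real n * (real n - 1)))" if "2 \<le> n" for n
  proof -
    let ?N = "uniform_elliptope n" and ?L = "unit_diag_lebesgue n"
    have n: "0 < n" using that by simp
    interpret prob_space ?N
      by (rule prob_space_uniform_elliptope) fact
    have E_pos: "0 < E n"
      using that by (simp add: E)
    have EZ: "expectation (Z n) = E n / 2"
      using n by (simp add: Z(3) E card_upper_indices)
    have [measurable]: "g n \<in> borel_measurable ?L" "Z n \<in> borel_measurable ?N"
      by (rule g_meas[OF n], rule Z(1)[OF n])
    have "P n = prob (unit_diag_mat n -` {C \<in> space ?L. \<bar>g n C / E n - 1\<bar> > \<epsilon>} \<inter> space ?N)"
      unfolding P_def U_def uniform_correlation_eq_distr space_distr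
      by (rule measure_distr) measurable
    \<comment> \<open>Since \<open>g n\<close> becomes \<open>2 * Z n\<close> in coordinates, a
      relative deviation of \<open>\<epsilon>\<close> means that \<open>Z n\<close> is off its mean
      \<open>E n / 2\<close> by \<open>\<epsilon> * E n / 2\<close>.\<close>
    also have "\<dots> \<le> prob {x \<in> space ?N. \<bar>Z n x - expectation (Z n)\<bar> \<ge> \<epsilon> * E n / 2}"
    proof (rule finite_measure_mono)
      show "unit_diag_mat n -` {C \<in> space ?L. \<bar>g n C / E n - 1\<bar> > \<epsilon>} \<inter> space ?N
          \<subseteq> {x \<in> space ?N. \<bar>Z n x - expectation (Z n)\<bar> \<ge> \<epsilon> * E n / 2}"
      proof (clarsimp simp: g EZ)
        fix x assume "\<epsilon> < \<bar>2 * Z n x / E n - 1\<bar>"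
        also have "2 * Z n x / E n - 1 = (2 * Z n x - E n) / E n"
          using E_pos by (simp add: field_simps)
        finally have "\<epsilon> * E n < \<bar>2 * Z n x - E n\<bar>"
          using E_pos by (simp add: pos_less_divide_eq)
        then show "\<epsilon> * E n \<le> \<bar>Z n x - E n / 2\<bar> * 2"
          by (simp add: abs_if split: if_splits)
      qed
    qed measurable
    also have "\<dots> \<le> variance (Z n) / (\<epsilon> * E n / 2)\<^sup>2"
      using \<epsilon> E_pos by (intro Chebyshev_inequality Z n) simp
    \<comment> \<open>The variance of \<open>Z n\<close> is at most its mean, so it is of smaller
      order than the squared mean.\<close>
    also have "\<dots> \<le> (E n / 2) / (\<epsilon> * E n / 2)\<^sup>2"
      using Z(3,4)[OF n] EZ by (intro divide_right_mono) (linarith, simp)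
    also have "\<dots> = 1 / \<epsilon>\<^sup>2 * (2 / E n)"
      using \<epsilon> E_pos by (simp add: power2_eq_square field_simps)
    also have "2 / E n = 2 * (real n + 1) / (real n * (real n - 1))"
      using n by (simp add: E)
    finally show ?thesis .
  qed
  then have upper: "\<forall>\<^sub>F n in sequentially. P n \<le> 1 / \<epsilon>\<^sup>2 * (2 * (real n + 1) / (real n * (real n - 1)))"
    by (intro eventually_sequentiallyI[of 2])
  have "(\<lambda>n. 2 * (real n + 1) / (real n * (real n - 1))) \<longlonglongrightarrow> 0"
    by real_asymp
  then have "(\<lambda>n. 1 / \<epsilon>\<^sup>2 * (2 * (real n + 1) / (real n * (real n - 1)))) \<longlonglongrightarrow> 0"
    by (rule tendsto_mult_right_zero)
  moreover have "0 \<le> P n" for n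
    unfolding P_def by (rule measure_nonneg)
  ultimately have "P \<longlonglongrightarrow> 0"
    by (intro tendsto_sandwich[OF always_eventually upper tendsto_const]) blast
  then show "(\<lambda>n. \<P>(C in U n. \<bar>(frobenius_norm (C - 1\<^sub>m n))\<^sup>2 / E n - 1\<bar> > \<epsilon>)) \<longlonglongrightarrow> 0"
    unfolding P_def g_def .
qed

end
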